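(* Let $D$ be a positive squarefree integer and let $(p,r,q)$ and $(p_0,r_0,q_0)$ be triples of positive integers each satisfying $p^2+Dr^2=q^2$, $\gcd(p,q)=1$, $p/q\le1/2$ (resp. with $p_0,r_0,q_0$). Put $d_1=\gcd(q_0r,qr_0)$, $d_2=\gcd(d_1,p_0r-r_0p)$, fix $a,b\in\mathbb{Z}$ with $aq_0r+bqr_0=d_1$, and define the positive definite integral binary quadratic form $$Q(m,n)=\frac1q\left[\frac{q_0^2q^2r_0^2}{d_1^2}m^2+\frac{a^2(r_0p-p_0r)^2q_0^2+2ad_1p_0q_0(r_0p-p_0r)+d_1^2q_0^2}{d_2^2}n^2+\frac{2a(r_0p-p_0r)qq_0^2r_0+2d_1qq_0r_0p_0}{d_1d_2}mn\right].$$ Then a sublattice $\Lambda$ of $\Omega_D(p_0,q_0)$ is similar to $\Omega_D(p,q)$ if and only if $$\Lambda=\sqrt{Q(m,n)}\;U\,\Gamma_D(p,q)$$ for some $m,n\in\mathbb{Z}$, not both zero, where $U$ is a real orthogonal matrix of the form $\begin{pmatrix}\cos t&-\sin t\\ \sin t&\cos t\end{pmatrix}$ or $\begin{pmatrix}\cos t&\sin t\\ \sin t&-\cos t\end{pmatrix}$ with $$\cos t=\frac{xp_0+yq_0}{\sqrt{qk}},\qquad \sin t=\frac{xr_0\sqrt D}{\sqrt{qk}},\qquad k=Q(m,n),$$ and where $(x,y)$ is either $\left(\frac{a(r_0p-p_0r)n}{d_2}+\frac{qr_0m}{d_1},\ \frac{d_1n}{d_2}\right)$ or $\left(\frac{d_1n}{d_2},\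 \frac{a(r_0p-p_0r)n}{d_2}+\frac{qr_0m}{d_1}\right)$. In this case $$|\Omega_D(p_0,q_0):\Lambda|=\frac{r\,Q(m,n)}{r_0q_0}.$$
   Context: For such a triple, $\Omega_D(p,q)=\begin{pmatrix} q & p\\ 0 & r\sqrt D\end{pmatrix}\mathbb{Z}^2\subset\mathbb{R}^2$ and $\Gamma_D(p,q)=\frac{1}{\sqrt q}\Omega_D(p,q)$. Two lattices $\Lambda_1,\Lambda_2\subset\mathbb{R}^2$ are similar if $\Lambda_2=\alpha V\Lambda_1$ for some $\alpha>0$ and $V\in O_2(\mathbb{R})$. *)

theory Defs
  imports "HOL-Analysis.Analysis" "HOL-Computational_Algebra.Squarefree"
begin

definition lattice_of :: "real^2^2 \<Rightarrow> (real^2) set" where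
  "lattice_of A = (\<lambda>z. A *v z) ` {z. \<forall>i. z $ i \<in> \<int>}"

text \<open>Lattices in the plane are of full rank, given by a basis matrix.\<close>

definition plane_lattice :: "(real^2) set \<Rightarrow> bool" where
  "plane_lattice L \<longleftrightarrow> (\<exists>A. invertible A \<and> L = lattice_of A)"

definition sublattice :: "(real^2) set \<Rightarrow> (real^2) set \<Rightarrow> bool" where
  "sublattice L M \<longleftrightarrow> plane_lattice L \<and> L \<subseteq> M"

definition similar_lattices :: "(real^2) set \<Rightarrow> (real^2) set \<Rightarrow> bool" where
  "similar_lattices L1 L2 \<longleftrightarrow>
     (\<exists>\<alpha> V. \<alpha> > 0 \<and> orthogonal_matrix V \<and> L2 = (\<lambda>v. \<alpha> *\<^sub>R (V *v v)) ` L1)"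

text \<open>The number of cosets of \<open>L\<close> in \<open>M\<close>; the value is 0 if there are infinitely many.\<close>

definition lattice_index :: "(real^2) set \<Rightarrow> (real^2) set \<Rightarrow> nat" where
  "lattice_index M L = card ((\<lambda>v. (\<lambda>w. v + w) ` L) ` M)"

text \<open>The entry \<open>r\<close> is determined by \<open>D\<close>, \<open>p\<close> and \<open>q\<close> through
  \<open>p\<^sup>2 + D r\<^sup>2 = q\<^sup>2\<close>; it is passed explicitly.\<close>

definition Omega :: "int \<Rightarrow> int \<Rightarrow> int \<Rightarrow> int \<Rightarrow> (real^2) set" where
  "Omega D p r q = lattice_of (vector [vector [of_int q, of_int p],
                                       vector [0, of_int r * sqrt (of_int D)]])"

definition Gamma_lat :: "int \<Rightarrow> int \<Rightarrow> int \<Rightarrow> int \<Rightarrow> (real^2) set" where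
  "Gamma_lat D p r q = (\<lambda>v. (1 / sqrt (of_int q)) *\<^sub>R v) ` Omega D p r q"

definition rotation_mat :: "real \<Rightarrow> real^2^2" where
  "rotation_mat t = vector [vector [cos t, - sin t], vector [sin t, cos t]]"

definition reflection_mat :: "real \<Rightarrow> real^2^2" where
  "reflection_mat t = vector [vector [cos t, sin t], vector [sin t, - cos t]]"

definition integral_form :: "(real \<Rightarrow> real \<Rightarrow> real) \<Rightarrow> bool" where
  "integral_form Q \<longleftrightarrow> (\<exists>A B C :: int. \<forall>u v.
     Q u v = of_int A * u\<^sup>2 + of_int B * u * v + of_int C * v\<^sup>2)"

definition positive_definite_form :: "(real \<Rightarrow> real \<Rightarrow> real) \<Rightarrow> bool" where
  "positive_definite_form Q \<longleftrightarrow> (\<forall>u v. (u, v) \<noteq> (0, 0) \<longrightarrow> Q u v > 0)"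

end

theory Submission imports Defs begin

text \<open>
  A copy of \<open>Omega D p r q\<close> inside \<open>Omega D p0 r0 q0\<close> is spanned by a vector
  \<open>u = x (p0, r0 \<surd>D) + y (q0, 0)\<close> and its rotation by \<open>\<plusminus>\<theta>\<close>, where \<open>cos \<theta> = p/q\<close>.
  Expressing the rotated vector in the basis of \<open>Omega D p0 r0 q0\<close>, integrality of one of its
  coordinates reads \<open>q r0 dvd y c - x q0 r\<close> with \<open>c = r0 p - p0 r\<close> (for \<open>-\<theta>\<close> the
  roles of \<open>x\<close> and \<open>y\<close> are exchanged). The solutions of this linear congruence are the pairs
  \<open>(x, y)\<close> parametrised by \<open>(m, n)\<close>, and \<open>Q(m, n) = |u|\<^sup>2 / q\<close>. Modulo \<open>q\<close> the
  congruence gives \<open>r\<^sup>2 |u|\<^sup>2 = y\<^sup>2 r0\<^sup>2 (p\<^sup>2 + D r\<^sup>2) = 0\<close>, and \<open>r\<close> is prime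
  to \<open>q\<close>, whence \<open>Q\<close> is integral. The index is the ratio of the determinants of the lattices.
\<close>

section \<open>Integer spans of two vectors\<close>

text \<open>Lattices are handled through a pair of generating vectors rather than a matrix, so that
  linear images and inclusions only have to be examined on two vectors.\<close>

definition int_span :: "'a::real_vector \<Rightarrow> 'a \<Rightarrow> 'a set" where
  "int_span u v = {of_int i *\<^sub>R u + of_int j *\<^sub>R v | i j. True}"

lemma int_spanI: "of_int i *\<^sub>R u + of_int j *\<^sub>R v \<in> int_span u v"
  unfolding int_span_def by blast

lemma int_span_generators: "u \<in> int_span u v" "v \<in> int_span u v"
  using int_spanI[of 1 u 0 v] int_spanI[of 0 u 1 v] by simp_all

lemma int_span_linear_image:
  assumes "linear f"
  shows "f ` int_span u v = int_span (f u) (f v)"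
proof -
  have "f (of_int i *\<^sub>R u + of_int j *\<^sub>R v) = of_int i *\<^sub>R f u + of_int j *\<^sub>R f v" for i j
    using assms by (simp add: linear_add linear_scale)
  then show ?thesis
    unfolding int_span_def by (auto simp: image_def) metis+
qed

lemma int_span_subset:
  assumes "u' \<in> int_span u v" "v' \<in> int_span u v"
  shows "int_span u' v' \<subseteq> int_span u v"
proof
  fix z assume "z \<in> int_span u' v'"
  then obtain i j where z: "z = of_int i *\<^sub>R u' + of_int j *\<^sub>R v'"
    unfolding int_span_def by blast
  obtain a b where u': "u' = of_int a *\<^sub>R u + of_int b *\<^sub>R v"
    using assms(1) unfolding int_span_def by blast
  obtain c d where v': "v' = of_int c *\<^sub>R u + of_int d *\<^sub>R v"
    using assms(2) unfolding int_span_def by blast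
  have "z = of_int (i*a + j*c) *\<^sub>R u + of_int (i*b + j*d) *\<^sub>R v"
    unfolding z u' v' by (simp add: algebra_simps)
  then show "z \<in> int_span u v"
    using int_spanI by metis
qed

lemma lattice_of_eq_int_span:
  "lattice_of (vector [vector [a, b], vector [c, d]]) = int_span (vector [a, c]) (vector [b, d])"
proof (intro equalityI subsetI)
  fix v assume "v \<in> lattice_of (vector [vector [a, b], vector [c, d]])"
  then obtain z :: "real^2" where z: "\<forall>i. z $ i \<in> \<int>"
    and v: "v = vector [vector [a, b], vector [c, d]] *v z"
    unfolding lattice_of_def by blast
  obtain i j where ij: "z $ 1 = of_int i" "z $ 2 = of_int j"
    using z by (metis Ints_cases)
  have "v = of_int i *\<^sub>R vector [a, c] + of_int j *\<^sub>R vector [b, d]"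
    unfolding v by (simp add: vec_eq_iff forall_2 matrix_vector_mult_def sum_2 ij)
  then show "v \<in> int_span (vector [a, c]) (vector [b, d])"
    by (simp add: int_spanI)
next
  fix v :: "real^2" assume "v \<in> int_span (vector [a, c]) (vector [b, d])"
  then obtain i j where v: "v = of_int i *\<^sub>R vector [a, c] + of_int j *\<^sub>R vector [b, d]"
    unfolding int_span_def by blast
  let ?z = "vector [of_int i, of_int j] :: real^2"
  have "v = vector [vector [a, b], vector [c, d]] *v ?z"
    unfolding v by (simp add: vec_eq_iff forall_2 matrix_vector_mult_def sum_2)
  moreover have "\<forall>i. ?z $ i \<in> \<int>"
    by (simp add: forall_2)
  ultimately show "v \<in> lattice_of (vector [vector [a, b], vector [c, d]])"
    unfolding lattice_of_def by blast
qed

section \<open>Cosets and the index\<close>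

lemma coset_int_span_eq_iff:
  "(\<lambda>w. x + w) ` int_span u v = (\<lambda>w. y + w) ` int_span u v \<longleftrightarrow> x - y \<in> int_span u v"
proof
  assume "(\<lambda>w. x + w) ` int_span u v = (\<lambda>w. y + w) ` int_span u v"
  moreover have "x \<in> (\<lambda>w. x + w) ` int_span u v"
    using int_spanI[of 0 u 0 v] by force
  ultimately show "x - y \<in> int_span u v"
    by auto
next
  assume "x - y \<in> int_span u v"
  then obtain i j where ij: "x - y = of_int i *\<^sub>R u + of_int j *\<^sub>R v"
    unfolding int_span_def by blast
  have plus: "(x - y) + w \<in> int_span u v" and minus: "w - (x - y) \<in> int_span u v"
    if w: "w \<in> int_span u v" for w
  proof -
    obtain k l where "w = of_int k *\<^sub>R u + of_int l *\<^sub>R v"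
      using w unfolding int_span_def by blast
    then have "(x - y) + w = of_int (i + k) *\<^sub>R u + of_int (j + l) *\<^sub>R v"
      "w - (x - y) = of_int (k - i) *\<^sub>R u + of_int (l - j) *\<^sub>R v"
      unfolding ij by (simp_all add: algebra_simps)
    then show "(x - y) + w \<in> int_span u v" "w - (x - y) \<in> int_span u v"
      by (metis int_spanI)+
  qed
  show "(\<lambda>w. x + w) ` int_span u v = (\<lambda>w. y + w) ` int_span u v"
  proof (intro equalityI subsetI)
    fix z assume "z \<in> (\<lambda>w. x + w) ` int_span u v"
    then obtain w where "w \<in> int_span u v" "z = x + w" by blast
    then show "z \<in> (\<lambda>w. y + w) ` int_span u v"
      using plus[of w] by (intro image_eqI[of _ _ "(x - y) + w"]) auto
  next
    fix z assume "z \<in> (\<lambda>w. y + w) ` int_span u v"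
    then obtain w where "w \<in> int_span u v" "z = y + w" by blast
    then show "z \<in> (\<lambda>w. x + w) ` int_span u v"
      using minus[of w] by (intro image_eqI[of _ _ "w - (x - y)"]) auto
  qed
qed

text \<open>For generators in Hermite normal form, the points \<open>i e + j f\<close> with
  \<open>0 \<le> i < g\<close> and \<open>0 \<le> j < h\<close> form a complete system of coset
  representatives. The first coordinate is reduced by the first generator, then the second by
  \<open>h f\<close>.\<close>

lemma lattice_index_triangular:
  fixes e f :: "real^2" and g h s :: int
  assumes indep: "\<And>i j :: int. of_int i *\<^sub>R e + of_int j *\<^sub>R f = 0 \<Longrightarrow> i = 0 \<and> j = 0"
    and "g > 0" "h > 0"
  shows "lattice_index (int_span e f) (int_span (of_int g *\<^sub>R e + of_int s *\<^sub>R f) (of_int h *\<^sub>R f))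
    = nat (g * h)"
proof -
  define L where "L = int_span (of_int g *\<^sub>R e + of_int s *\<^sub>R f) (of_int h *\<^sub>R f)"
  define pt where "pt = (\<lambda>(i::int, j::int). of_int i *\<^sub>R e + of_int j *\<^sub>R f)"
  define coset where "coset = (\<lambda>v. (\<lambda>w. v + w) ` L)"
  have mem: "pt (i, j) \<in> L \<longleftrightarrow> (\<exists>k l. i = k * g \<and> j = k * s + l * h)" for i j
  proof
    assume "pt (i, j) \<in> L"
    then obtain k l where "pt (i, j) = of_int k *\<^sub>R (of_int g *\<^sub>R e + of_int s *\<^sub>R f) + of_int l *\<^sub>R (of_int h *\<^sub>R f)"
      unfolding L_def int_span_def by blast
    then have "of_int (i - k * g) *\<^sub>R e + of_int (j - (k * s + l * h)) *\<^sub>R f = 0"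
      unfolding pt_def by (simp add: algebra_simps)
    from indep[OF this] show "\<exists>k l. i = k * g \<and> j = k * s + l * h"
      by (intro exI[of _ k] exI[of _ l]) auto
  next
    assume "\<exists>k l. i = k * g \<and> j = k * s + l * h"
    then obtain k l where "i = k * g" "j = k * s + l * h" by blast
    then have "pt (i, j) = of_int k *\<^sub>R (of_int g *\<^sub>R e + of_int s *\<^sub>R f) + of_int l *\<^sub>R (of_int h *\<^sub>R f)"
      unfolding pt_def by (simp add: algebra_simps)
    then show "pt (i, j) \<in> L"
      unfolding L_def by (simp only: int_spanI)
  qed
  have coset_eq: "coset (pt (i, j)) = coset (pt (i', j')) \<longleftrightarrow> pt (i - i', j - j') \<in> L" for i j i' j'
  proof -
    have "pt (i - i', j - j') = pt (i, j) - pt (i', j')"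
      unfolding pt_def by (simp add: algebra_simps)
    then show ?thesis
      unfolding coset_def L_def by (simp only: coset_int_span_eq_iff)
  qed
  have "inj_on (\<lambda>z. coset (pt z)) ({0..<g} \<times> {0..<h})"
  proof (rule inj_onI)
    fix z z' assume z: "z \<in> {0..<g} \<times> {0..<h}" "z' \<in> {0..<g} \<times> {0..<h}"
      and eq: "coset (pt z) = coset (pt z')"
    obtain i j i' j' where zz: "z = (i, j)" "z' = (i', j')" by (cases z, cases z') blast
    then obtain k l where kl: "i - i' = k * g" "j - j' = k * s + l * h"
      using eq mem coset_eq by metis
    have "i mod g = i' mod g"
      using kl(1) by (metis mod_eq_dvd_iff dvd_triv_right)
    then have i: "i = i'" using z zz by simp
    then have "k = 0" using kl(1) \<open>g > 0\<close> by simp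
    then have "j mod h = j' mod h"
      using kl(2) by (metis mod_eq_dvd_iff dvd_triv_right mult_zero_left add_0)
    then show "z = z'" using z zz i by simp
  qed
  moreover have "(\<lambda>z. coset (pt z)) ` ({0..<g} \<times> {0..<h}) = coset ` int_span e f"
  proof (intro equalityI subsetI)
    fix C assume "C \<in> (\<lambda>z. coset (pt z)) ` ({0..<g} \<times> {0..<h})"
    then show "C \<in> coset ` int_span e f"
      unfolding pt_def by (auto simp: int_spanI)
  next
    fix C assume "C \<in> coset ` int_span e f"
    then obtain i j where C: "C = coset (pt (i, j))"
      unfolding int_span_def pt_def by auto
    \<comment> \<open>Subtracting \<open>k\<close> times the first generator leaves
      \<open>i mod g\<close> in front of \<open>e\<close> but shifts the other coordinate by
      \<open>k * s\<close>, so it is \<open>j - k * s\<close> that gets reduced modulo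
      \<open>h\<close>.\<close>
    define k where "k = i div g"
    define l where "l = (j - k * s) div h"
    have "i - i mod g = k * g"
      unfolding k_def by (simp add: minus_mod_eq_div_mult)
    moreover have "j - (j - k * s) mod h = k * s + l * h"
      unfolding l_def using minus_mod_eq_div_mult[of "j - k * s" h] by linarith
    ultimately have "C = coset (pt (i mod g, (j - k * s) mod h))"
      unfolding C coset_eq mem by blast
    then show "C \<in> (\<lambda>z. coset (pt z)) ` ({0..<g} \<times> {0..<h})"
      using \<open>g > 0\<close> \<open>h > 0\<close> by (intro image_eqI[of _ _ "(i mod g, (j - k * s) mod h)"]) auto
  qed
  ultimately have "card (coset ` int_span e f) = card ({0..<g} \<times> {0..<h})"
    by (metis card_image)
  then show ?thesis
    using \<open>g > 0\<close> unfolding lattice_index_def coset_def L_def by (simp add: nat_mult_distrib)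
qed

text \<open>A unimodular change of generators brings the pair to triangular form: a Bezout
  combination has \<open>e\<close>-coordinate \<open>gcd a b\<close>, and a second combination has
  \<open>e\<close>-coordinate 0. The index is then the product of the diagonal entries.\<close>

lemma lattice_index_int_span:
  fixes e f :: "real^2" and a b c d :: int
  assumes indep: "\<And>i j :: int. of_int i *\<^sub>R e + of_int j *\<^sub>R f = 0 \<Longrightarrow> i = 0 \<and> j = 0"
    and det: "a * d - b * c \<noteq> 0"
  shows "lattice_index (int_span e f)
      (int_span (of_int a *\<^sub>R e + of_int c *\<^sub>R f) (of_int b *\<^sub>R e + of_int d *\<^sub>R f))
    = nat \<bar>a * d - b * c\<bar>"
proof -
  define g where "g = gcd a b"
  have g: "g > 0" using det unfolding g_def by auto
  obtain k l where kl: "k * a + l * b = g"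
    unfolding g_def using bezout_int by blast
  obtain a' b' where ab: "a = g * a'" "b = g * b'"
    unfolding g_def by (meson dvdE gcd_dvd1 gcd_dvd2)
  have unim: "k * a' + l * b' = 1"
  proof -
    have "g * (k * a' + l * b') = g * 1" using kl unfolding ab by (simp add: algebra_simps)
    then show ?thesis using g by simp
  qed
  \<comment> \<open>\<open>s\<close> is the \<open>f\<close>-coordinate of the Bezout combination
    \<open>k u + l v\<close>; the sign \<open>\<sigma>\<close> makes the second diagonal entry
    \<open>h\<close> positive.\<close>
  define s where "s = c * k + d * l"
  define \<sigma> where "\<sigma> = sgn (a' * d - b' * c)"
  define h where "h = \<bar>a' * d - b' * c\<bar>"
  have deteq: "a * d - b * c = g * (a' * d - b' * c)" unfolding ab by (simp add: algebra_simps)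
  then have nz: "a' * d - b' * c \<noteq> 0" using det by auto
  then have h: "h > 0" unfolding h_def by simp
  have \<sigma>h: "\<sigma> * (a' * d - b' * c) = h" "\<sigma> * h = a' * d - b' * c"
    unfolding \<sigma>_def h_def by (simp_all add: sgn_if abs_if)
  let ?u = "of_int a *\<^sub>R e + of_int c *\<^sub>R f" and ?v = "of_int b *\<^sub>R e + of_int d *\<^sub>R f"
  let ?u' = "of_int g *\<^sub>R e + of_int s *\<^sub>R f" and ?v' = "of_int h *\<^sub>R f"
  have combine: "of_int i *\<^sub>R (of_int x *\<^sub>R e + of_int y *\<^sub>R f) + of_int j *\<^sub>R (of_int z *\<^sub>R e + of_int w *\<^sub>R f)
      = of_int (i * x + j * z) *\<^sub>R e + of_int (i * y + j * w) *\<^sub>R f" for i j x y z w :: int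
    by (simp add: algebra_simps)
  have "?u' = of_int k *\<^sub>R ?u + of_int l *\<^sub>R ?v"
    unfolding combine kl s_def by (simp add: mult.commute)
  then have 1: "?u' \<in> int_span ?u ?v" by (simp only: int_spanI)
  \<comment> \<open>The combination \<open>- b' u + a' v\<close> cancels \<open>e\<close>, because
    \<open>a\<close> and \<open>b\<close> are \<open>g\<close> times \<open>a'\<close> and
    \<open>b'\<close>.\<close>
  have "\<sigma> * - b' * a + \<sigma> * a' * b = 0" "\<sigma> * - b' * c + \<sigma> * a' * d = h"
    unfolding \<sigma>h(1)[symmetric] ab by (simp_all add: algebra_simps)
  then have "?v' = of_int (\<sigma> * - b') *\<^sub>R ?u + of_int (\<sigma> * a') *\<^sub>R ?v"
    unfolding combine by (simp only: of_int_0 scale_zero_left add_0)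
  then have 2: "?v' \<in> int_span ?u ?v" by (simp only: int_spanI)
  \<comment> \<open>The change of generators has rows \<open>(k, l)\<close> and
    \<open>(- \<sigma> b', \<sigma> a')\<close> and determinant \<open>\<sigma>\<close>. Its inverse
    has rows \<open>(a', - \<sigma> l)\<close> and \<open>(b', \<sigma> k)\<close>, the coefficients
    used here and for \<open>?v\<close>. The zero multiple of \<open>e\<close> below puts
    \<open>?v'\<close> into the shape that \<open>combine\<close> rewrites.\<close>
  have 3: "?u \<in> int_span ?u' ?v'"
  proof -
    have "a' * s + (\<sigma> * - l) * h = a' * s - l * (\<sigma> * h)" by simp
    also have "\<dots> = c * (k * a' + l * b')" unfolding \<sigma>h(2) s_def by (simp add: algebra_simps)
    finally have "a' * s + (\<sigma> * - l) * h = c" unfolding unim by simp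
    then have "?u = of_int a' *\<^sub>R ?u' + of_int (\<sigma> * - l) *\<^sub>R (of_int 0 *\<^sub>R e + of_int h *\<^sub>R f)"
      unfolding combine ab by (simp add: mult.commute)
    then show ?thesis by (metis int_spanI add_0 of_int_0 scale_zero_left)
  qed
  have 4: "?v \<in> int_span ?u' ?v'"
  proof -
    have "b' * s + (\<sigma> * k) * h = b' * s + k * (\<sigma> * h)" by simp
    also have "\<dots> = d * (k * a' + l * b')" unfolding \<sigma>h(2) s_def by (simp add: algebra_simps)
    finally have "b' * s + (\<sigma> * k) * h = d" unfolding unim by simp
    then have "?v = of_int b' *\<^sub>R ?u' + of_int (\<sigma> * k) *\<^sub>R (of_int 0 *\<^sub>R e + of_int h *\<^sub>R f)"
      unfolding combine ab by (simp add: mult.commute)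
    then show ?thesis by (metis int_spanI add_0 of_int_0 scale_zero_left)
  qed
  have "int_span ?u ?v = int_span ?u' ?v'"
    using int_span_subset[OF 1 2] int_span_subset[OF 3 4] by blast
  moreover have "g * h = \<bar>a * d - b * c\<bar>"
    unfolding deteq h_def using g by (simp add: abs_mult)
  ultimately show ?thesis
    using lattice_index_triangular[OF indep g h] by simp
qed

section \<open>Orthogonal matrices of the plane\<close>

text \<open>The first column is a unit vector \<open>(cos t, sin t)\<close>; the second is a unit
  vector orthogonal to it, which leaves only a sign.\<close>

lemma orthogonal_matrix_2_cases:
  fixes W :: "real^2^2"
  assumes "orthogonal_matrix W"
  obtains t where "W = rotation_mat t \<or> W = reflection_mat t"
proof -
  have "transpose W ** W = mat 1"
    using assms by (simp add: orthogonal_matrix)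
  then have c: "(W$1$1)\<^sup>2 + (W$2$1)\<^sup>2 = 1" "(W$1$2)\<^sup>2 + (W$2$2)\<^sup>2 = 1"
    "W$1$1 * W$1$2 + W$2$1 * W$2$2 = 0"
    by (simp_all add: vec_eq_iff forall_2 matrix_matrix_mult_def transpose_def sum_2 mat_def
        power2_eq_square algebra_simps)
  obtain t where t: "W$1$1 = cos t" "W$2$1 = sin t"
    using sincos_total_2pi[OF c(1)] by metis
  \<comment> \<open>This is the determinant of \<open>W\<close>, and also the component of the
    second column along \<open>(- sin t, cos t)\<close>.\<close>
  define l where "l = W$2$2 * cos t - W$1$2 * sin t"
  have sc: "sin t * sin t + cos t * cos t = 1" by (metis power2_eq_square sin_cos_squared_add)
  have 12: "W$1$2 = - (l * sin t)" and 22: "W$2$2 = l * cos t"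
    using c(3) sc unfolding l_def t by algebra+
  have "l\<^sup>2 = 1"
    using c(2) sc unfolding 12 22 by algebra
  then have "l = 1 \<or> l = -1" by (simp add: power2_eq_1_iff)
  then have "W = rotation_mat t \<or> W = reflection_mat t"
    by (auto simp: rotation_mat_def reflection_mat_def vec_eq_iff forall_2 t 12 22)
  then show ?thesis by (rule that)
qed

section \<open>A linear congruence in two unknowns\<close>

text \<open>Since \<open>d1\<close> divides both \<open>s\<close> and \<open>N\<close>, it must
  divide \<open>y * c\<close>, which restricts \<open>y\<close> to multiples of
  \<open>d1 div d2\<close>. After division by \<open>d1\<close> the coefficient of \<open>x\<close>
  is a unit modulo \<open>N div d1\<close>, with inverse \<open>a\<close> by the Bezout relation, so
  \<open>x\<close> is determined modulo \<open>N div d1\<close>.\<close>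

lemma linear_congruence_solutions:
  fixes a b c d1 d2 s N x y :: int
  assumes "N > 0" and d1: "d1 = gcd s N" and d2: "d2 = gcd d1 c" and ab: "a * s + b * N = d1"
  shows "N dvd y * c - x * s \<longleftrightarrow>
    (\<exists>m n. x = a * (c div d2) * n + (N div d1) * m \<and> y = (d1 div d2) * n)"
proof -
  have d1p: "d1 > 0" using \<open>N > 0\<close> unfolding d1 by simp
  then have d2p: "d2 > 0" unfolding d2 by simp
  define s' N' c' e where "s' = s div d1" "N' = N div d1" "c' = c div d2" "e = d1 div d2"
  note defs = this
  have s: "s = d1 * s'" and N: "N = d1 * N'" unfolding defs d1 by simp_all
  have c: "c = d2 * c'" and e: "d1 = d2 * e" unfolding defs d2 by simp_all
  have "d1 * (a * s' + b * N') = d1 * 1"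
    using ab s N by (metis distrib_left mult.left_commute mult.right_neutral)
  then have inv: "a * s' + b * N' = 1" using d1p by simp
  have cop: "coprime e c'"
    unfolding defs using d2p d2 div_gcd_coprime[of d1 c] d1p by auto
  show ?thesis
    unfolding defs(2-4)[symmetric]
  proof
    assume dvd: "N dvd y * c - x * s"
    then have "d1 dvd y * c - x * s" using N by (metis dvd_mult_left)
    then have "d1 dvd y * c" using s by (metis dvd_mult dvd_triv_left diff_add_cancel dvd_add)
    then have "e dvd y * c'" using d2p unfolding e c by (simp add: mult.left_commute)
    then have "e dvd y" using cop by (simp add: coprime_dvd_mult_left_iff)
    then obtain n where y: "y = e * n" by blast
    have "y * c - x * s = d1 * (n * c' - x * s')"
      unfolding y s c by (simp add: e algebra_simps)
    then have "N' dvd n * c' - x * s'" using dvd d1p N by simp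
    then obtain z where z: "n * c' - x * s' = N' * z" by blast
    \<comment> \<open>Multiply the preceding equation by \<open>a\<close> and replace
      \<open>a * s'\<close> by \<open>1 - b * N'\<close>.\<close>
    have "x = a * c' * n + N' * (b * x - a * z)"
      using inv z by algebra
    then show "\<exists>m n. x = a * c' * n + N' * m \<and> y = e * n" using y by blast
  next
    assume "\<exists>m n. x = a * c' * n + N' * m \<and> y = e * n"
    then obtain m n where x: "x = a * c' * n + N' * m" and y: "y = e * n" by blast
    have "y * c - x * s = d1 * (n * c' * (1 - a * s') - s' * N' * m)"
      unfolding x y s c by (simp add: e algebra_simps)
    also have "1 - a * s' = b * N'" using inv by simp
    finally have "y * c - x * s = N * (n * c' * b - s' * m)"
      unfolding N by (simp add: algebra_simps)
    then show "N dvd y * c - x * s" by simp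
  qed
qed

section \<open>Determinants and the lattices \<open>Omega\<close>\<close>

text \<open>The index is the absolute determinant of the integer coordinate matrix, and determinants
  are multiplicative. This form spares the computation of those coordinates.\<close>

lemma lattice_index_eq_det_ratio:
  fixes e f u w :: "real^2"
  assumes ef: "e$1 * f$2 - e$2 * f$1 \<noteq> 0" and uw: "u$1 * w$2 - u$2 * w$1 \<noteq> 0"
    and sub: "int_span u w \<subseteq> int_span e f"
  shows "real (lattice_index (int_span e f) (int_span u w))
    = \<bar>u$1 * w$2 - u$2 * w$1\<bar> / \<bar>e$1 * f$2 - e$2 * f$1\<bar>"
proof -
  have "u \<in> int_span e f" "w \<in> int_span e f"
    using sub int_span_generators by blast+
  then obtain a b c d where u: "u = of_int a *\<^sub>R e + of_int c *\<^sub>R f"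
    and w: "w = of_int b *\<^sub>R e + of_int d *\<^sub>R f"
    unfolding int_span_def by blast
  have det: "u$1 * w$2 - u$2 * w$1 = of_int (a * d - b * c) * (e$1 * f$2 - e$2 * f$1)"
    unfolding u w by (simp add: algebra_simps)
  then have nz: "a * d - b * c \<noteq> 0" using uw by (metis mult_zero_left of_int_0)
  have "i = 0 \<and> j = 0" if "of_int i *\<^sub>R e + of_int j *\<^sub>R f = 0" for i j :: int
  proof -
    have "of_int i * e$1 + of_int j * f$1 = 0" "of_int i * e$2 + of_int j * f$2 = 0"
      using that by (simp_all add: vec_eq_iff forall_2)
    then have "of_int i * (e$1 * f$2 - e$2 * f$1) = 0" "of_int j * (e$1 * f$2 - e$2 * f$1) = 0"
      by algebra+
    then show ?thesis using ef by simp
  qed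
  from lattice_index_int_span[OF this nz]
  have "real (lattice_index (int_span e f) (int_span u w)) = \<bar>of_int (a * d - b * c)\<bar>"
    unfolding u w by simp
  then show ?thesis
    unfolding det using ef by (simp add: abs_mult)
qed

lemma Omega_eq_int_span:
  "Omega D p r q = int_span (vector [of_int q, 0]) (vector [of_int p, of_int r * sqrt (of_int D)])"
  unfolding Omega_def by (rule lattice_of_eq_int_span)

lemma linear_scaled_matrix: "linear (\<lambda>v. s *\<^sub>R ((U::real^2^2) *v v))"
  by (intro linearI) (simp_all add: matrix_vector_right_distrib scaleR_right_distrib
      matrix_vector_mult_scaleR)

lemma scaled_matrix_Gamma_lat:
  "(\<lambda>v. s *\<^sub>R (U *v v)) ` Gamma_lat D p r q = (\<lambda>v. (s / sqrt (of_int q)) *\<^sub>R (U *v v)) ` Omega D p r q"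
  unfolding Gamma_lat_def image_image by (simp add: matrix_vector_mult_scaleR)

text \<open>The vector \<open>\<beta> q (X, Y)\<close> is \<open>x (p0, r0 \<surd>D) + y (q0, 0)\<close>, and \<open>(x', y')\<close> belongs in the
  same way to its rotation by the angle with cosine \<open>p/q\<close>; a negative \<open>r\<close> reverses the rotation.\<close>

lemma rotated_vector_coordinates:
  fixes D p r q p0 r0 q0 x y x' y' :: int and \<beta> X Y :: real
  assumes "D > 0" "q0 > 0" and eq0: "p0\<^sup>2 + D * r0\<^sup>2 = q0\<^sup>2"
    and X: "\<beta> * (of_int q * X) = of_int (x * p0 + y * q0)"
    and Y: "\<beta> * (of_int q * Y) = of_int (x * r0) * sqrt (of_int D)"
    and X': "\<beta> * (of_int p * X - of_int r * sqrt (of_int D) * Y) = of_int (x' * p0 + y' * q0)"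
    and Y': "\<beta> * (of_int p * Y + of_int r * sqrt (of_int D) * X) = of_int (x' * r0) * sqrt (of_int D)"
  shows "q * r0 * x' = x * (r0 * p + p0 * r) + y * (q0 * r)"
    and "q * r0 * y' = y * (r0 * p - p0 * r) - x * (q0 * r)"
proof -
  define s where "s = sqrt (real_of_int D)"
  have s: "s * s = of_int D" "s \<noteq> 0" using \<open>D > 0\<close> unfolding s_def by simp_all
  note XY = X Y X' Y'
  \<comment> \<open>Second components: \<open>Y'\<close> times \<open>q\<close>, with
    \<open>X\<close> and \<open>Y\<close> substituted. The first components are treated likewise
    below, where \<open>s * s\<close> becomes \<open>D\<close>.\<close>
  have "s * (of_int (q * x' * r0)) = s * of_int (p * x * r0 + r * (x * p0 + y * q0))"
    using XY unfolding s_def[symmetric] of_int_mult of_int_add by algebra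
  then have 1: "q * x' * r0 = p * x * r0 + r * (x * p0 + y * q0)"
    using s(2) by (metis mult_left_cancel of_int_eq_iff)
  then show "q * r0 * x' = x * (r0 * p + p0 * r) + y * (q0 * r)"
    by (simp add: algebra_simps)
  have "real_of_int (q * (x' * p0 + y' * q0)) = of_int (p * (x * p0 + y * q0) - r * x * r0 * D)"
    using XY s(1) unfolding s_def[symmetric] of_int_mult of_int_add of_int_diff by algebra
  then have "q * (x' * p0 + y' * q0) = p * (x * p0 + y * q0) - r * x * r0 * D"
    by (simp only: of_int_eq_iff)
  \<comment> \<open>Eliminating \<open>x'\<close> produces
    \<open>x * r * (p0\<^sup>2 + D * r0\<^sup>2)\<close>, which \<open>eq0\<close> turns into a
    multiple of \<open>q0\<close>.\<close>
  with 1 eq0 have "q0 * (q * r0 * y') = q0 * (y * (r0 * p - p0 * r) - x * (q0 * r))"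
    by algebra
  then show "q * r0 * y' = y * (r0 * p - p0 * r) - x * (q0 * r)"
    using \<open>q0 > 0\<close> by simp
qed

theorem theorem3p2:
  fixes D p r q p0 r0 q0 d1 d2 a b :: int
    and Q :: "real \<Rightarrow> real \<Rightarrow> real"
  assumes "D > 0" and "squarefree D"
    and "p > 0" and "r > 0" and "q > 0"
    and "p\<^sup>2 + D * r\<^sup>2 = q\<^sup>2" and "gcd p q = 1" and "real_of_int p / real_of_int q \<le> 1 / 2"
    and "p0 > 0" and "r0 > 0" and "q0 > 0"
    and "p0\<^sup>2 + D * r0\<^sup>2 = q0\<^sup>2" and "gcd p0 q0 = 1" and "real_of_int p0 / real_of_int q0 \<le> 1 / 2"
    and d1: "d1 = gcd (q0 * r) (q * r0)"
    and d2: "d2 = gcd d1 (p0 * r - r0 * p)"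
    and ab: "a * q0 * r + b * q * r0 = d1"
    and Q: "Q = (\<lambda>m n. (1 / real_of_int q) *
       (real_of_int (q0\<^sup>2 * q\<^sup>2 * r0\<^sup>2) / real_of_int (d1\<^sup>2) * m\<^sup>2
        + real_of_int (a\<^sup>2 * (r0 * p - p0 * r)\<^sup>2 * q0\<^sup>2
                       + 2 * a * d1 * p0 * q0 * (r0 * p - p0 * r) + d1\<^sup>2 * q0\<^sup>2)
            / real_of_int (d2\<^sup>2) * n\<^sup>2
        + real_of_int (2 * a * (r0 * p - p0 * r) * q * q0\<^sup>2 * r0 + 2 * d1 * q * q0 * r0 * p0)
            / real_of_int (d1 * d2) * m * n))"
  shows "positive_definite_form Q \<and> integral_form Q \<and>
    (\<forall>\<Lambda>. sublattice \<Lambda> (Omega D p0 r0 q0) \<longrightarrow>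
      (let represented = (\<lambda>m n :: int. (m, n) \<noteq> (0, 0) \<and>
             (\<exists>U t x y k.
                k = Q (real_of_int m) (real_of_int n) \<and>
                ((x, y) = (real_of_int (a * (r0 * p - p0 * r) * n) / real_of_int d2
                             + real_of_int (q * r0 * m) / real_of_int d1,
                           real_of_int (d1 * n) / real_of_int d2)
                 \<or> (x, y) = (real_of_int (d1 * n) / real_of_int d2,
                           real_of_int (a * (r0 * p - p0 * r) * n) / real_of_int d2
                             + real_of_int (q * r0 * m) / real_of_int d1)) \<and>
                cos t = (x * real_of_int p0 + y * real_of_int q0) / sqrt (real_of_int q * k) \<and>
                sin t = x * real_of_int r0 * sqrt (real_of_int D) / sqrt (real_of_int q * k) \<and>
                (U = rotation_mat t \<or> U = reflection_mat t) \<and>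
                \<Lambda> = (\<lambda>v. sqrt k *\<^sub>R (U *v v)) ` Gamma_lat D p r q))
       in (similar_lattices \<Lambda> (Omega D p r q) \<longleftrightarrow> (\<exists>m n. represented m n)) \<and>
          (\<forall>m n. represented m n \<longrightarrow>
             real (lattice_index (Omega D p0 r0 q0) \<Lambda>)
               = real_of_int r * Q (real_of_int m) (real_of_int n) / real_of_int (r0 * q0))))"
proof -
  define c where "c = r0 * p - p0 * r"
  define s where "s = sqrt (real_of_int D)"
  have s: "s * s = of_int D" "s > 0" using \<open>D > 0\<close> unfolding s_def by simp_all
  have d1_pos: "d1 > 0" using assms(3-5,9-11) unfolding d1 by simp
  then have d2_pos: "d2 > 0" unfolding d2 by simp
  have d2': "d2 = gcd d1 c"
    unfolding d2 c_def by (metis gcd_neg2_int minus_diff_eq)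
  have N_pos: "q * r0 > 0" using assms(5,10) by simp
  have sol: "q * r0 dvd y * c - x * (q0 * r) \<longleftrightarrow>
    (\<exists>m n. x = a * (c div d2) * n + (q * r0 div d1) * m \<and> y = (d1 div d2) * n)" for x y
    using linear_congruence_solutions[OF N_pos d1 d2', of a b] ab by (simp add: mult.assoc)
  have rdiv: "real_of_int (c div d2) = of_int c / of_int d2"
    "real_of_int (d1 div d2) = of_int d1 / of_int d2"
    "real_of_int (q * r0 div d1) = of_int (q * r0) / of_int d1"
  proof -
    have "d2 dvd c" "d2 dvd d1" "d1 dvd q * r0" using d2' d1 by (metis gcd_dvd1 gcd_dvd2)+
    then show "real_of_int (c div d2) = of_int c / of_int d2"
      "real_of_int (d1 div d2) = of_int d1 / of_int d2"
      "real_of_int (q * r0 div d1) = of_int (q * r0) / of_int d1"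
      by (simp_all add: real_of_int_div)
  qed

  \<comment> \<open>The norm form and integrality of \<open>Q\<close>\<close>
  \<comment> \<open>\<open>F x y\<close> is the squared length of
    \<open>x (p0, r0 \<surd>D) + y (q0, 0)\<close>. Both basis vectors have length
    \<open>q0\<close>, hence the symmetry in \<open>x\<close> and \<open>y\<close>, which makes the
    two choices of \<open>(x, y)\<close> lead to the same \<open>k\<close>.\<close>
  define F where "F = (\<lambda>x y :: real. (of_int q0)\<^sup>2 * x\<^sup>2 + 2 * of_int p0 * of_int q0 * x * y + (of_int q0)\<^sup>2 * y\<^sup>2)"
  have F_comm: "F x y = F y x" for x y unfolding F_def by (simp add: algebra_simps)
  have eq0: "(of_int q0)\<^sup>2 = (of_int p0)\<^sup>2 + s\<^sup>2 * (real_of_int r0)\<^sup>2"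
    using assms(12) unfolding power2_eq_square[of s] s(1) by (metis of_int_add of_int_mult of_int_power)
  have F_norm: "F x y = (x * of_int p0 + y * of_int q0)\<^sup>2 + (x * of_int r0 * s)\<^sup>2" for x y
    unfolding F_def using eq0 by algebra
  have F_pos: "F x y > 0" if "(x, y) \<noteq> (0, 0)" for x y
  proof (cases "x = 0")
    case True
    then show ?thesis using that assms(11) unfolding F_def by simp
  next
    case False
    then show ?thesis unfolding F_norm using s(2) assms(10) by (intro add_nonneg_pos) simp_all
  qed
  \<comment> \<open>The parametrisation in \<open>sol\<close>, extended to real arguments;
    substituting it into \<open>F\<close> yields the coefficients of \<open>Q\<close>.\<close>
  define X where "X = (\<lambda>m n :: real. of_int (a * c) * n / of_int d2 + of_int (q * r0) * m / of_int d1)"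
  define Y where "Y = (\<lambda>n :: real. of_int d1 * n / of_int d2)"
  have Q_F: "Q m n = F (X m n) (Y n) / of_int q" for m n
    unfolding Q F_def X_def Y_def c_def using d1_pos d2_pos assms(5)
    by (simp add: field_simps power2_eq_square)
  have XY_nz: "(X m n, Y n) \<noteq> (0, 0)" if "(m, n) \<noteq> (0, 0)" for m n
    using that d1_pos d2_pos N_pos assms(5,10) unfolding X_def Y_def by auto
  have Q_pos: "Q m n > 0" if "(m, n) \<noteq> (0, 0)" for m n
    unfolding Q_F using F_pos[OF XY_nz[OF that]] assms(5) by simp
  have X_int: "X (of_int m) (of_int n) = of_int (a * (c div d2) * n + (q * r0 div d1) * m)"
    and Y_int: "Y (of_int n) = of_int ((d1 div d2) * n)" for m n :: int
    unfolding X_def Y_def by (simp_all add: rdiv)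

  have cop: "coprime q (r\<^sup>2)"
  proof -
    have "coprime q r"
    proof (rule coprimeI)
      fix k assume k: "k dvd q" "k dvd r"
      have "p\<^sup>2 = q * q - (D * r) * r" using assms(6) by (simp add: power2_eq_square)
      then have "k dvd p\<^sup>2" using k by simp
      moreover have "coprime k (p\<^sup>2)"
        using assms(7) k(1) by (metis coprime_commute coprime_divisors coprime_iff_gcd_eq_1 coprime_power_right_iff dvd_refl)
      ultimately show "is_unit k" by (metis coprime_common_divisor dvd_refl)
    qed
    then show ?thesis by simp
  qed
  have F_dvd: "\<exists>z. F (of_int x) (of_int y) / of_int q = of_int z"
    if dvd: "q * r0 dvd y * c - x * (q0 * r)" for x y :: int
  proof -
    define G where "G = q0\<^sup>2 * x\<^sup>2 + 2 * p0 * q0 * x * y + q0\<^sup>2 * y\<^sup>2"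
    obtain z where z: "y * c - x * (q0 * r) = q * r0 * z" using dvd by blast
    \<comment> \<open>Completing the square, \<open>G\<close> is
      \<open>(q0 x + p0 y)\<^sup>2 + D r0\<^sup>2 y\<^sup>2\<close>, and the congruence gives
      \<open>r (q0 x + p0 y) = r0 (y p - q z)\<close>.\<close>
    have "r\<^sup>2 * G = q * (y\<^sup>2 * r0\<^sup>2 * q - 2 * y * r0\<^sup>2 * p * z + q * r0\<^sup>2 * z\<^sup>2)"
      using z assms(6,12) unfolding c_def G_def by algebra
    then have "q dvd r\<^sup>2 * G" by simp
    then have "q dvd G" using cop by (simp add: coprime_dvd_mult_right_iff)
    then obtain w where "G = q * w" by blast
    moreover have "F (of_int x) (of_int y) = of_int G" unfolding F_def G_def by simp
    ultimately show ?thesis using assms(5) by (intro exI[of _ w]) simp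
  qed
  have Q_int: "\<exists>z. Q (of_int m) (of_int n) = of_int z" for m n :: int
    unfolding Q_F X_int Y_int by (intro F_dvd) (use sol in blast)
  have "integral_form Q"
  proof -
    \<comment> \<open>A binary quadratic form is determined by these three values; the mixed
      coefficient is \<open>E - A - C\<close>.\<close>
    obtain A C E where A: "Q 1 0 = of_int A" and C: "Q 0 1 = of_int C" and E: "Q 1 1 = of_int E"
      using Q_int[of 1 0] Q_int[of 0 1] Q_int[of 1 1] by auto
    have "Q u v = of_int A * u\<^sup>2 + of_int (E - A - C) * u * v + of_int C * v\<^sup>2" for u v
      unfolding of_int_diff A[symmetric] C[symmetric] E[symmetric] unfolding Q by (simp add: algebra_simps)
    then show ?thesis unfolding integral_form_def by blast
  qed
  moreover have "positive_definite_form Q"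
    unfolding positive_definite_form_def using Q_pos by blast
  \<comment> \<open>\<open>R\<close> is the predicate \<open>represented\<close> written with
    \<open>X\<close>, \<open>Y\<close> and \<open>s\<close>; the last step unfolds these
    abbreviations.\<close>
  moreover have "(similar_lattices \<Lambda> (Omega D p r q) \<longleftrightarrow> (\<exists>m n. R m n)) \<and>
     (\<forall>m n. R m n \<longrightarrow> real (lattice_index (Omega D p0 r0 q0) \<Lambda>)
               = real_of_int r * Q (real_of_int m) (real_of_int n) / real_of_int (r0 * q0))"
    if sub: "sublattice \<Lambda> (Omega D p0 r0 q0)"
      and R: "R = (\<lambda>m n :: int. (m, n) \<noteq> (0, 0) \<and>
             (\<exists>U t x y k.
                k = Q (real_of_int m) (real_of_int n) \<and>
                ((x, y) = (X (of_int m) (of_int n), Y (of_int n))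
                 \<or> (x, y) = (Y (of_int n), X (of_int m) (of_int n))) \<and>
                cos t = (x * real_of_int p0 + y * real_of_int q0) / sqrt (real_of_int q * k) \<and>
                sin t = x * real_of_int r0 * s / sqrt (real_of_int q * k) \<and>
                (U = rotation_mat t \<or> U = reflection_mat t) \<and>
                \<Lambda> = (\<lambda>v. sqrt k *\<^sub>R (U *v v)) ` Gamma_lat D p r q))" for \<Lambda> R
  proof (intro conjI iffI allI impI)

    \<comment> \<open>From similarity to a representation\<close>
    assume "similar_lattices \<Lambda> (Omega D p r q)"
    then obtain \<alpha> V where \<alpha>: "\<alpha> > 0" and V: "orthogonal_matrix V"
      and Om: "Omega D p r q = (\<lambda>v. \<alpha> *\<^sub>R (V *v v)) ` \<Lambda>"
      unfolding similar_lattices_def by blast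
    \<comment> \<open>\<open>\<beta>\<close> and \<open>W\<close> describe the inverse similarity,
      carrying \<open>Omega D p r q\<close> onto \<open>\<Lambda>\<close>.\<close>
    define \<beta> where "\<beta> = 1 / \<alpha>"
    define W where "W = transpose V"
    have \<beta>: "\<beta> > 0" unfolding \<beta>_def using \<alpha> by simp
    have "\<Lambda> = (\<lambda>v. \<beta> *\<^sub>R (W *v v)) ` Omega D p r q"
      unfolding Om image_image \<beta>_def W_def using \<alpha> V
      by (simp add: matrix_vector_mult_scaleR matrix_vector_mul_assoc orthogonal_matrix)
    moreover have "orthogonal_matrix W"
      unfolding W_def using V by simp
    then obtain t where W: "W = rotation_mat t \<or> W = reflection_mat t"
      by (rule orthogonal_matrix_2_cases)
    ultimately have \<Lambda>: "\<Lambda> = (\<lambda>v. \<beta> *\<^sub>R (W *v v)) ` Omega D p r q" by blast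
    define u w :: "real^2" where "u = \<beta> *\<^sub>R (W *v vector [of_int q, 0])"
      and "w = \<beta> *\<^sub>R (W *v vector [of_int p, of_int r * s])"
    have "\<Lambda> = int_span u w"
      unfolding \<Lambda> Omega_eq_int_span u_def w_def s_def by (rule int_span_linear_image[OF linear_scaled_matrix])
    then have "u \<in> Omega D p0 r0 q0" "w \<in> Omega D p0 r0 q0"
      using sub int_span_generators unfolding sublattice_def by blast+
    then obtain x y x' y' where uv: "u = of_int y *\<^sub>R vector [of_int q0, 0] + of_int x *\<^sub>R vector [of_int p0, of_int r0 * s]"
      "w = of_int y' *\<^sub>R vector [of_int q0, 0] + of_int x' *\<^sub>R vector [of_int p0, of_int r0 * s]"
      unfolding Omega_eq_int_span int_span_def s_def by blast
    have u: "\<beta> * (of_int q * cos t) = of_int (x * p0 + y * q0)" "\<beta> * (of_int q * sin t) = of_int (x * r0) * s"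
    proof -
      have "u $ 1 = \<beta> * (of_int q * cos t)" "u $ 2 = \<beta> * (of_int q * sin t)"
        using W unfolding u_def
        by (auto simp: rotation_mat_def reflection_mat_def matrix_vector_mult_def sum_2)
      then show "\<beta> * (of_int q * cos t) = of_int (x * p0 + y * q0)" "\<beta> * (of_int q * sin t) = of_int (x * r0) * s"
        unfolding uv by (simp_all add: algebra_simps)
    qed
    have F_xy: "F (of_int x) (of_int y) = (\<beta> * of_int q)\<^sup>2"
    proof -
      have "F (of_int x) (of_int y) = (\<beta> * (of_int q * cos t))\<^sup>2 + (\<beta> * (of_int q * sin t))\<^sup>2"
        unfolding F_norm u by simp
      also have "\<dots> = (\<beta> * of_int q)\<^sup>2 * ((cos t)\<^sup>2 + (sin t)\<^sup>2)"
        by algebra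
      finally show ?thesis by simp
    qed
    \<comment> \<open>The rotation case gives the first alternative, the reflection case the
      second.\<close>
    have "q * r0 dvd y * c - x * (q0 * r) \<or> q * r0 dvd x * c - y * (q0 * r)"
      using W
    proof
      assume W: "W = rotation_mat t"
      have "w $ 1 = \<beta> * (of_int p * cos t - of_int r * s * sin t)"
        "w $ 2 = \<beta> * (of_int p * sin t + of_int r * s * cos t)"
        unfolding w_def W by (simp_all add: rotation_mat_def matrix_vector_mult_def sum_2 algebra_simps)
      then have w: "\<beta> * (of_int p * cos t - of_int r * s * sin t) = of_int (x' * p0 + y' * q0)"
        "\<beta> * (of_int p * sin t + of_int r * s * cos t) = of_int (x' * r0) * s"
        unfolding uv by (simp_all add: algebra_simps)
      have "q * r0 * y' = y * c - x * (q0 * r)"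
        unfolding c_def using assms(1,11,12) u w unfolding s_def by (rule rotated_vector_coordinates(2))
      then show ?thesis by (metis dvd_triv_left)
    next
      \<comment> \<open>Now \<open>w\<close> is \<open>u\<close> turned the opposite way, which
        amounts to replacing \<open>r\<close> by \<open>- r\<close>; the \<open>x'\<close>
        coordinate then supplies the congruence with \<open>x\<close> and \<open>y\<close>
        exchanged.\<close>
      assume W: "W = reflection_mat t"
      have "w $ 1 = \<beta> * (of_int p * cos t - of_int (- r) * s * sin t)"
        "w $ 2 = \<beta> * (of_int p * sin t + of_int (- r) * s * cos t)"
        unfolding w_def W by (simp_all add: reflection_mat_def matrix_vector_mult_def sum_2 algebra_simps)
      then have w: "\<beta> * (of_int p * cos t - of_int (- r) * s * sin t) = of_int (x' * p0 + y' * q0)"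
        "\<beta> * (of_int p * sin t + of_int (- r) * s * cos t) = of_int (x' * r0) * s"
        unfolding uv by (simp_all add: algebra_simps)
      have "q * r0 * x' = x * (r0 * p + p0 * (- r)) + y * (q0 * (- r))"
        using assms(1,11,12) u w unfolding s_def by (rule rotated_vector_coordinates(1))
      then have "q * r0 * x' = x * c - y * (q0 * r)" unfolding c_def by (simp add: algebra_simps)
      then show ?thesis by (metis dvd_triv_left)
    qed
    then obtain m n where mn: "(of_int x, of_int y) = (X (of_int m) (of_int n), Y (of_int n))
      \<or> (of_int x, of_int y) = (Y (of_int n), X (of_int m) (of_int n))"
      unfolding sol X_int Y_int by blast
    define k where "k = Q (of_int m) (of_int n)"
    \<comment> \<open>Both sides equal the squared length of \<open>u\<close> divided by
      \<open>q\<close>.\<close>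
    have k: "k = \<beta>\<^sup>2 * of_int q"
    proof -
      have "F (X (of_int m) (of_int n)) (Y (of_int n)) = (\<beta> * of_int q)\<^sup>2"
        using mn F_xy F_comm by auto
      then show ?thesis unfolding k_def Q_F using assms(5) by (simp add: power2_eq_square)
    qed
    have "(m, n) \<noteq> (0, 0)"
    proof
      assume "(m, n) = (0, 0)"
      then have "k = 0" unfolding k_def Q by simp
      then show False using k \<beta> assms(5) by simp
    qed
    moreover have sqk: "sqrt (of_int q * k) = \<beta> * of_int q"
      unfolding k using \<beta> assms(5) by (intro real_sqrt_unique) (simp_all add: power2_eq_square)
    moreover have "cos t = (of_int x * of_int p0 + of_int y * of_int q0) / (\<beta> * of_int q)"
      "sin t = of_int x * of_int r0 * s / (\<beta> * of_int q)"
      using u \<beta> assms(5) by (simp_all add: field_simps)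
    moreover have "sqrt k / sqrt (of_int q) = \<beta>"
      unfolding k using \<beta> assms(5) by (simp add: real_sqrt_mult)
    then have "\<Lambda> = (\<lambda>v. sqrt k *\<^sub>R (W *v v)) ` Gamma_lat D p r q"
      unfolding scaled_matrix_Gamma_lat \<Lambda> by simp
    ultimately have "R m n"
      unfolding R using k_def mn W by metis
    then show "\<exists>m n. R m n" by blast
  next

    \<comment> \<open>From a representation to similarity\<close>
    assume "\<exists>m n. R m n"
    then obtain m n U t where mn: "(m, n) \<noteq> (0, 0)" and U: "U = rotation_mat t \<or> U = reflection_mat t"
      and \<Lambda>: "\<Lambda> = (\<lambda>v. sqrt (Q (of_int m) (of_int n)) *\<^sub>R (U *v v)) ` Gamma_lat D p r q"
      unfolding R by blast
    \<comment> \<open>The total scale factor from \<open>Omega D p r q\<close> to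
      \<open>\<Lambda>\<close>, with the factor built into \<open>Gamma_lat\<close> absorbed. The
      similarity sought is the inverse map, given by \<open>1 / \<beta>\<close> and the transpose of
      \<open>U\<close>.\<close>
    define \<beta> where "\<beta> = sqrt (Q (of_int m) (of_int n)) / sqrt (of_int q)"
    have \<beta>: "\<beta> > 0" unfolding \<beta>_def using Q_pos mn assms(5) by simp
    have "transpose U ** U = mat 1"
      using U sin_cos_squared_add3[of t]
      by (auto simp: rotation_mat_def reflection_mat_def vec_eq_iff forall_2
          matrix_matrix_mult_def transpose_def sum_2 mat_def algebra_simps)
    moreover from this have "orthogonal_matrix (transpose U)"
      by (metis orthogonal_matrix orthogonal_matrix_transpose)
    moreover have "Omega D p r q = (\<lambda>v. (1 / \<beta>) *\<^sub>R (transpose U *v v)) ` \<Lambda>"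
      unfolding \<Lambda> scaled_matrix_Gamma_lat \<beta>_def[symmetric] image_image using \<beta> \<open>transpose U ** U = mat 1\<close>
      by (simp add: matrix_vector_mult_scaleR matrix_vector_mul_assoc)
    ultimately show "similar_lattices \<Lambda> (Omega D p r q)"
      unfolding similar_lattices_def using \<beta> by (metis zero_less_divide_1_iff)
  next

    \<comment> \<open>The index\<close>
    fix m n assume "R m n"
    then obtain U t where mn: "(m, n) \<noteq> (0, 0)" and U: "U = rotation_mat t \<or> U = reflection_mat t"
      and \<Lambda>: "\<Lambda> = (\<lambda>v. sqrt (Q (of_int m) (of_int n)) *\<^sub>R (U *v v)) ` Gamma_lat D p r q"
      unfolding R by blast
    define k where "k = Q (of_int m) (of_int n)"
    define \<beta> where "\<beta> = sqrt k / sqrt (of_int q)"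
    have k: "k > 0" unfolding k_def using Q_pos mn by simp
    have \<beta>: "\<beta> * \<beta> * of_int q = k" unfolding \<beta>_def using k assms(5) by simp
    define u w :: "real^2" where "u = \<beta> *\<^sub>R (U *v vector [of_int q, 0])"
      and "w = \<beta> *\<^sub>R (U *v vector [of_int p, of_int r * s])"
    have \<Lambda>_span: "\<Lambda> = int_span u w"
      unfolding \<Lambda> scaled_matrix_Gamma_lat Omega_eq_int_span u_def w_def s_def \<beta>_def k_def
      by (rule int_span_linear_image[OF linear_scaled_matrix])
    \<comment> \<open>The determinant of the basis of \<open>Omega D p r q\<close> is
      \<open>q r s\<close>; scaling multiplies it by \<open>\<beta>\<^sup>2\<close> and
      \<open>U\<close> by 1 or -1.\<close>
    have det: "\<bar>u$1 * w$2 - u$2 * w$1\<bar> = k * of_int r * s"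
    proof -
      have sc: "sin t * sin t + cos t * cos t = 1" by (metis power2_eq_square sin_cos_squared_add)
      have "u$1 * w$2 - u$2 * w$1 = k * of_int r * s \<or> u$1 * w$2 - u$2 * w$1 = - (k * of_int r * s)"
        using U
      proof
        assume U: "U = rotation_mat t"
        have "u$1 * w$2 - u$2 * w$1 = (\<beta> * \<beta> * of_int q) * of_int r * s * (sin t * sin t + cos t * cos t)"
          unfolding u_def w_def U
          by (simp add: rotation_mat_def matrix_vector_mult_def sum_2 algebra_simps
              del: sin_cos_squared_add3)
        then show ?thesis unfolding sc \<beta> by simp
      next
        assume U: "U = reflection_mat t"
        have "u$1 * w$2 - u$2 * w$1 = - ((\<beta> * \<beta> * of_int q) * of_int r * s * (sin t * sin t + cos t * cos t))"
          unfolding u_def w_def U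
          by (simp add: reflection_mat_def matrix_vector_mult_def sum_2 algebra_simps
              del: sin_cos_squared_add3)
        then show ?thesis unfolding sc \<beta> by simp
      qed
      moreover have "k * of_int r * s > 0" using k s(2) assms(4) by simp
      ultimately show ?thesis by auto
    qed
    \<comment> \<open>The irrational factor \<open>s\<close> occurs in both determinants and cancels
      in the final formula.\<close>
    have "real (lattice_index (Omega D p0 r0 q0) \<Lambda>) = (k * of_int r * s) / \<bar>of_int q0 * (of_int r0 * s)\<bar>"
      unfolding \<Lambda>_span Omega_eq_int_span s_def[symmetric]
    proof (subst lattice_index_eq_det_ratio)
      show "u$1 * w$2 - u$2 * w$1 \<noteq> 0" using det k s(2) assms(4) by auto
      show "int_span u w \<subseteq> int_span (vector [of_int q0, 0]) (vector [of_int p0, of_int r0 * s])"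
        using sub unfolding sublattice_def \<Lambda>_span Omega_eq_int_span s_def by blast
    qed (use det s(2) assms(10,11) in simp_all)
    then show "real (lattice_index (Omega D p0 r0 q0) \<Lambda>)
        = real_of_int r * Q (real_of_int m) (real_of_int n) / real_of_int (r0 * q0)"
      using s(2) assms(10,11) unfolding k_def by (simp add: abs_mult mult.commute)
  qed
  ultimately show ?thesis
    unfolding Let_def X_def Y_def c_def s_def by simp
qed

end
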